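(* Let $(X,\preceq)$ be a locally compact and order-connected Hausdorff topological $\wedge$-semilattice. Then the map $x\mapsto x^{\downarrow}$ topologically order-embeds $(X,\preceq)$ in $(\mathcal{C}(X),\subseteq)$, where $\mathcal{C}(X)$ is endowed with the Fell topology.
   Context: A Hausdorff topological $\wedge$-semilattice is a poset $(X,\preceq)$ in which the greatest lower bound $x\wedge y$ exists for all $x,y\in X$, where $X$ carries a Hausdorff topology such that $(x,y)\mapsto x\wedge y$ is continuous from $X\times X$ into $X$. (Then $\preceq$ is closed in $X\times X$, so principal ideals are closed.) For $x\in X$, $x^{\downarrow}:=\{z\in X:z\preceq x\}$ and $x^{\uparrow}:=\{z\in X:x\preceq z\}$. $(X,\preceq)$ is order-connected if $x^{\uparrow}\cap y^{\downarrow}$ is a connected subset of $X$ for all $x,y\in X$ with $x\preceq y$. $\mathcal{C}(X)$ is the set of all closed subsets of $X$ (including $\varnothing$), ordered by inclusion. The Fell topology on $\mathcal{C}(X)$ is generated (as a subbase) by all sets $\{A\in\mathcal{C}(X):A\cap O\neq\varnothing\}$ with $O\subseteq X$ open, and all sets $\{A\in\mathcal{C}(X):A\subseteq X\setminus K\}$ with $K\subseteq X$ compact. A map $\phi:(X_1,\preceq_1)\to(X_2,\preceq_2)$ topologically order-embeds if $x\preceq_1 y\iff\phi(x)\preceq_2\phi(y)$ for all $x,y\in X_1$ and $\phi$ is a homeomorphism from $X_1$ onto $\phi(X_1)$ with the subspace topology. *)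

theory Defs
  imports "HOL-Analysis.Analysis" "HOL-Algebra.Lattice"
begin

text \<open>
  The order is a HOL-Algebra order structure \<open>L\<close> and the topology an abstract topology \<open>X\<close>
  on the same carrier set; neither has to exhaust the underlying type.
\<close>

locale hausdorff_topological_lower_semilattice = lower_semilattice L
  for L :: "('a, 'm) gorder_scheme" (structure) +
  fixes X :: "'a topology"
  assumes topspace_eq_carrier: "topspace X = carrier L"
    and Hausdorff: "Hausdorff_space X"
    and continuous_meet: "continuous_map (prod_topology X X) X (\<lambda>(x, y). x \<sqinter> y)"

definition principal_ideal :: "('a, 'm) gorder_scheme \<Rightarrow> 'a \<Rightarrow> 'a set"
  where "principal_ideal L x = {z \<in> carrier L. z \<sqsubseteq>\<^bsub>L\<^esub> x}"

definition principal_filter :: "('a, 'm) gorder_scheme \<Rightarrow> 'a \<Rightarrow> 'a set"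
  where "principal_filter L x = {z \<in> carrier L. x \<sqsubseteq>\<^bsub>L\<^esub> z}"

definition order_connected :: "('a, 'm) gorder_scheme \<Rightarrow> 'a topology \<Rightarrow> bool"
  where "order_connected L X \<longleftrightarrow>
    (\<forall>x \<in> carrier L. \<forall>y \<in> carrier L.
      x \<sqsubseteq>\<^bsub>L\<^esub> y \<longrightarrow> connectedin X (principal_filter L x \<inter> principal_ideal L y))"

definition closed_sets_order :: "'a topology \<Rightarrow> 'a set gorder"
  where "closed_sets_order X = \<lparr>carrier = {A. closedin X A}, eq = (=), le = (\<subseteq>)\<rparr>"

definition fell_topology :: "'a topology \<Rightarrow> 'a set topology"
  where "fell_topology X = topology_generated_by
    ({{A. closedin X A \<and> A \<inter> U \<noteq> {}} | U. openin X U} \<union>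
     {{A. closedin X A \<and> A \<subseteq> topspace X - K} | K. compactin X K})"

lemma topspace_fell_topology: "topspace (fell_topology X) = carrier (closed_sets_order X)"
proof -
  let ?S = "{{A. closedin X A \<and> A \<inter> U \<noteq> {}} | U. openin X U} \<union>
     {{A. closedin X A \<and> A \<subseteq> topspace X - K} | K. compactin X K}"
  have "{A. closedin X A} \<in> ?S"
    using closedin_subset by (intro UnI2 CollectI exI[of _ "{}"]) auto
  then have "{A. closedin X A} \<subseteq> \<Union> ?S" by (rule Union_upper)
  moreover have "\<Union> ?S \<subseteq> {A. closedin X A}" by blast
  ultimately show ?thesis
    unfolding fell_topology_def closed_sets_order_def topology_generated_by_topspace
    by (simp add: subset_antisym)
qed

definition topological_order_embedding ::
  "('a, 'm) gorder_scheme \<Rightarrow> 'a topology \<Rightarrow> ('b, 'n) gorder_scheme \<Rightarrow> 'b topology \<Rightarrow> ('a \<Rightarrow> 'b) \<Rightarrow> bool"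
  where "topological_order_embedding L X M Y f \<longleftrightarrow>
    f \<in> carrier L \<rightarrow> carrier M \<and> order_emb L M f \<and> embedding_map X Y f"

end

theory Submission
  imports Defs
begin

text \<open>
  Write \<open>A\<^sup>\<up>\<close> and \<open>A\<^sup>\<down>\<close> for the up-set and the down-set generated by \<open>A\<close>. Since \<open>x \<sqsubseteq> y\<close> means
  \<open>x \<sqinter> y = x\<close>, the order is the equaliser of two continuous maps into a Hausdorff space, hence
  closed in \<open>X \<times> X\<close>. Projecting along a compact factor is a closed map, so \<open>K\<^sup>\<up>\<close> and \<open>K\<^sup>\<down>\<close> are closed
  for every compact \<open>K\<close> (\<open>closedin_up_set_compact\<close>, \<open>closedin_down_set_compact\<close>).

  Continuity of \<open>x \<mapsto> x\<^sup>\<down>\<close> is tested on the subbase. The ideal \<open>x\<^sup>\<down>\<close> misses a compact \<open>K\<close> iff \<open>x\<close> lies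
  outside the closed set \<open>K\<^sup>\<up>\<close>. If \<open>x\<^sup>\<down>\<close> hits an open \<open>U\<close> in \<open>z\<close>, then \<open>z \<sqinter> x = z\<close> is in \<open>U\<close>, and for \<open>y\<close>
  near \<open>x\<close> the element \<open>z \<sqinter> y\<close> of \<open>y\<^sup>\<down>\<close> still is.

  Continuity of the inverse is where local compactness and order-connectedness enter
  (\<open>fell_neighbourhood_forces_closeness\<close>). Let \<open>x \<in> V \<subseteq> K \<subseteq> U\<close> with \<open>V\<close> open and \<open>K\<close> compact, and suppose
  that \<open>y\<^sup>\<down>\<close> contains a point \<open>z\<close> close to \<open>x\<close> although \<open>y \<notin> U\<close>. The interval between \<open>z\<close> and \<open>y\<close> is
  connected, starts in \<open>V\<close> and ends outside \<open>K\<close>, so it meets the shell \<open>K - V\<close> in some \<open>w\<close>. Hence it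
  suffices to require that \<open>y\<^sup>\<down>\<close> hit a small neighbourhood of \<open>x\<close> and miss the part of the shell above
  that neighbourhood. This compact part is disjoint from \<open>x\<^sup>\<down>\<close> once the neighbourhood
  avoids the closed set generated downwards by the shell points below \<open>x\<close>; it can do so because, by
  antisymmetry, \<open>x\<close> is below none of these.
\<close>

section \<open>Images of compact sets under closed relations\<close>

text \<open>
  The image is the projection to \<open>Y\<close> of the part of \<open>R\<close> over \<open>K\<close>, and projections along a compact
  space are closed maps.
\<close>

lemma closedin_Image_compactin:
  assumes R: "closedin (prod_topology X Y) R" and K: "compactin X K"
  shows "closedin Y (R `` K)"
proof -
  have RXY: "R \<subseteq> topspace X \<times> topspace Y"
    using closedin_subset[OF R] by simp
  have "compact_space (subtopology X K)"
    using K by (simp add: compactin_subspace)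
  then have cl: "closed_map (prod_topology (subtopology X K) Y) Y snd"
    by (rule closed_map_snd)
  have "prod_topology (subtopology X K) Y = subtopology (prod_topology X Y) (K \<times> topspace Y)"
    using subtopology_Times[of X Y K "topspace Y"] by simp
  then have "closedin (prod_topology (subtopology X K) Y) (R \<inter> K \<times> topspace Y)"
    using R by (auto simp: closedin_subtopology)
  then have "closedin Y (snd ` (R \<inter> K \<times> topspace Y))"
    using cl by (simp add: closed_map_def)
  moreover have "snd ` (R \<inter> K \<times> topspace Y) = R `` K"
    using RXY by force
  ultimately show ?thesis by simp
qed

section \<open>Closedness in Hausdorff topological meet-semilattices\<close>

context hausdorff_topological_lower_semilattice
begin

lemma le_iff_meet_eq:
  assumes "x \<in> carrier L" "y \<in> carrier L"
  shows "x \<sqsubseteq> y \<longleftrightarrow> x \<sqinter> y = x"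
  using assms by (metis le_antisym le_refl meet_closed meet_le meet_left meet_right)

lemma continuous_map_meet_left:
  assumes "z \<in> carrier L"
  shows "continuous_map X X (\<lambda>y. z \<sqinter> y)"
proof -
  have "continuous_map X (prod_topology X X) (\<lambda>y. (z, y))"
    using assms by (simp add: continuous_map_pairedI topspace_eq_carrier)
  from continuous_map_compose[OF this continuous_meet] show ?thesis
    by (simp add: o_def)
qed

definition order_graph :: "('a \<times> 'a) set"
  where "order_graph = {(x, y). x \<in> carrier L \<and> y \<in> carrier L \<and> x \<sqsubseteq> y}"

lemma closedin_order_graph: "closedin (prod_topology X X) order_graph"
proof -
  have "closedin (prod_topology X X)
      {p \<in> topspace (prod_topology X X). (\<lambda>(x, y). x \<sqinter> y) p = fst p}"
    by (rule closedin_continuous_maps_eq[OF Hausdorff continuous_meet continuous_map_fst])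
  moreover have "{p \<in> topspace (prod_topology X X). (\<lambda>(x, y). x \<sqinter> y) p = fst p} = order_graph"
    by (auto simp: order_graph_def topspace_eq_carrier le_iff_meet_eq)
  ultimately show ?thesis by simp
qed

lemma closedin_converse_order_graph: "closedin (prod_topology X X) (order_graph\<inverse>)"
proof -
  have "closedin (prod_topology X X)
      {p \<in> topspace (prod_topology X X). (\<lambda>(x, y). (y, x)) p \<in> order_graph}"
    using homeomorphic_map_swap closedin_order_graph
    by (blast intro: closedin_continuous_map_preimage homeomorphic_imp_continuous_map)
  moreover have "{p \<in> topspace (prod_topology X X). (\<lambda>(x, y). (y, x)) p \<in> order_graph}
      = order_graph\<inverse>"
    by (auto simp: order_graph_def topspace_eq_carrier)
  ultimately show ?thesis by simp
qed

definition up_set :: "'a set \<Rightarrow> 'a set"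
  where "up_set A = {y \<in> carrier L. \<exists>x \<in> A. x \<sqsubseteq> y}"

definition down_set :: "'a set \<Rightarrow> 'a set"
  where "down_set A = {x \<in> carrier L. \<exists>y \<in> A. x \<sqsubseteq> y}"

lemma closedin_up_set_compact:
  assumes "compactin X K"
  shows "closedin X (up_set K)"
proof -
  have "up_set K = order_graph `` K"
    using compactin_subset_topspace[OF assms]
    by (auto simp: up_set_def order_graph_def topspace_eq_carrier)
  then show ?thesis
    using closedin_Image_compactin[OF closedin_order_graph assms] by simp
qed

lemma closedin_down_set_compact:
  assumes "compactin X K"
  shows "closedin X (down_set K)"
proof -
  have "down_set K = order_graph\<inverse> `` K"
    using compactin_subset_topspace[OF assms]
    by (auto simp: down_set_def order_graph_def topspace_eq_carrier)
  then show ?thesis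
    using closedin_Image_compactin[OF closedin_converse_order_graph assms] by simp
qed

lemma closedin_principal_ideal:
  assumes "x \<in> carrier L"
  shows "closedin X (principal_ideal L x)"
proof -
  have "principal_ideal L x = down_set {x}"
    by (auto simp: principal_ideal_def down_set_def)
  then show ?thesis
    using assms closedin_down_set_compact[of "{x}"] by (simp add: topspace_eq_carrier)
qed

lemma principal_ideal_subset_iff:
  assumes "x \<in> carrier L" "y \<in> carrier L"
  shows "principal_ideal L x \<subseteq> principal_ideal L y \<longleftrightarrow> x \<sqsubseteq> y"
  using assms by (auto simp: principal_ideal_def intro: le_trans)

section \<open>The ideal map is continuous\<close>

lemma openin_ideal_hits:
  assumes U: "openin X U"
  shows "openin X {x \<in> carrier L. principal_ideal L x \<inter> U \<noteq> {}}" (is "openin X ?H")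
proof (subst openin_subopen, intro ballI)
  fix x assume "x \<in> ?H"
  then obtain z where x: "x \<in> carrier L" and z: "z \<in> carrier L" "z \<sqsubseteq> x" "z \<in> U"
    by (auto simp: principal_ideal_def)
  let ?N = "{y \<in> topspace X. z \<sqinter> y \<in> U}"
  have "openin X ?N"
    using continuous_map_meet_left[OF z(1)] U by (rule openin_continuous_map_preimage)
  moreover have "x \<in> ?N"
    using x z le_iff_meet_eq by (simp add: topspace_eq_carrier)
  moreover have "?N \<subseteq> ?H"
  proof
    fix y assume "y \<in> ?N"
    then have "y \<in> carrier L" "z \<sqinter> y \<in> principal_ideal L y \<inter> U"
      using z(1) by (simp_all add: topspace_eq_carrier principal_ideal_def meet_right)
    then show "y \<in> ?H" by blast
  qed
  ultimately show "\<exists>T. openin X T \<and> x \<in> T \<and> T \<subseteq> ?H" by blast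
qed

lemma openin_ideal_misses:
  assumes K: "compactin X K"
  shows "openin X {x \<in> carrier L. principal_ideal L x \<subseteq> topspace X - K}"
proof -
  have "{x \<in> carrier L. principal_ideal L x \<subseteq> topspace X - K} = topspace X - up_set K"
    using compactin_subset_topspace[OF K]
    by (auto simp: topspace_eq_carrier principal_ideal_def up_set_def)
  then show ?thesis
    using closedin_up_set_compact[OF K] by (simp add: closedin_def)
qed

lemma continuous_map_principal_ideal:
  "continuous_map X (fell_topology X) (principal_ideal L)"
  unfolding fell_topology_def
proof (rule continuous_on_generated_topo)
  fix \<U>
  assume "\<U> \<in> {{A. closedin X A \<and> A \<inter> U \<noteq> {}} | U. openin X U} \<union>
     {{A. closedin X A \<and> A \<subseteq> topspace X - K} | K. compactin X K}"
  then consider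
      (hits) U where "openin X U" "\<U> = {A. closedin X A \<and> A \<inter> U \<noteq> {}}"
    | (misses) K where "compactin X K" "\<U> = {A. closedin X A \<and> A \<subseteq> topspace X - K}"
    by blast
  then show "openin X (principal_ideal L -` \<U> \<inter> topspace X)"
  proof cases
    case hits
    then have "principal_ideal L -` \<U> \<inter> topspace X
        = {x \<in> carrier L. principal_ideal L x \<inter> U \<noteq> {}}"
      using closedin_principal_ideal by (auto simp: topspace_eq_carrier)
    then show ?thesis using openin_ideal_hits[OF hits(1)] by simp
  next
    case misses
    then have "principal_ideal L -` \<U> \<inter> topspace X
        = {x \<in> carrier L. principal_ideal L x \<subseteq> topspace X - K}"
      using closedin_principal_ideal by (auto simp: topspace_eq_carrier)
    then show ?thesis using openin_ideal_misses[OF misses(1)] by simp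
  qed
next
  have "principal_ideal L ` topspace X \<subseteq> topspace (fell_topology X)"
    using closedin_principal_ideal
    by (auto simp: topspace_fell_topology closed_sets_order_def topspace_eq_carrier)
  then show "principal_ideal L ` topspace X \<subseteq>
      \<Union> ({{A. closedin X A \<and> A \<inter> U \<noteq> {}} | U. openin X U} \<union>
     {{A. closedin X A \<and> A \<subseteq> topspace X - K} | K. compactin X K})"
    unfolding fell_topology_def topology_generated_by_topspace .
qed

section \<open>The inverse of the ideal map is continuous\<close>

text \<open>
  The interval between \<open>z\<close> and \<open>y\<close> is connected and meets both of the disjoint open sets \<open>V\<close> and
  \<open>X - K\<close>, so these two sets cannot cover it.
\<close>

lemma interval_meets_shell:
  assumes conn: "order_connected L X"
    and V: "openin X V" and K: "closedin X K" and "V \<subseteq> K"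
    and z: "z \<in> carrier L" "z \<in> V" and y: "y \<in> carrier L" "y \<notin> K" and "z \<sqsubseteq> y"
  obtains w where "w \<in> K - V" "w \<in> carrier L" "z \<sqsubseteq> w" "w \<sqsubseteq> y"
proof -
  let ?I = "principal_filter L z \<inter> principal_ideal L y"
  have I: "connectedin X ?I"
    using conn z y \<open>z \<sqsubseteq> y\<close> by (simp add: order_connected_def)
  have mem: "z \<in> ?I" "y \<in> ?I"
    using z y \<open>z \<sqsubseteq> y\<close> by (auto simp: principal_filter_def principal_ideal_def)
  have "\<not> ?I \<subseteq> V \<union> (topspace X - K)"
  proof
    assume "?I \<subseteq> V \<union> (topspace X - K)"
    moreover have "openin X (topspace X - K)"
      using K by (simp add: closedin_def)
    ultimately show False
      using connectedinD[OF I V, of "topspace X - K"] mem z y \<open>V \<subseteq> K\<close>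
      by (auto simp: topspace_eq_carrier)
  qed
  then show thesis
    using that by (auto simp: principal_filter_def principal_ideal_def topspace_eq_carrier)
qed

text \<open>
  The Fell neighbourhood consists of the sets that hit a small open \<open>W\<close> around \<open>x\<close> and miss the
  compact set \<open>C\<close> of shell points above a compact neighbourhood \<open>M \<supseteq> W\<close> of \<open>x\<close>. Taking shell points
  above \<open>M\<close> rather than above \<open>W\<close> is what makes \<open>C\<close> compact.
\<close>

lemma fell_neighbourhood_forces_closeness:
  assumes lc: "locally_compact_space X" and conn: "order_connected L X"
    and U: "openin X U" "x \<in> U"
  obtains \<N> where "openin (fell_topology X) \<N>" "principal_ideal L x \<in> \<N>"
    "\<And>y. y \<in> carrier L \<Longrightarrow> principal_ideal L y \<in> \<N> \<Longrightarrow> y \<in> U"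
proof -
  have x: "x \<in> carrier L"
    using U openin_subset topspace_eq_carrier by blast
  have nb: "neighbourhood_base_of (compactin X) X"
    using lc Hausdorff locally_compact_space_neighbourhood_base by blast
  obtain V K where V: "openin X V" "x \<in> V" "V \<subseteq> K" and K: "compactin X K" "K \<subseteq> U"
    using nb U unfolding neighbourhood_base_of by meson
  have clK: "closedin X K"
    using Hausdorff K(1) by (rule compactin_imp_closedin)
  have shell: "compactin X (K - V)"
    using closed_compactin[OF K(1) Diff_subset] closedin_diff[OF clK V(1)] by simp
  \<comment> \<open>A Fell neighbourhood of \<open>x\<^sup>\<down>\<close> cannot require these shell points to be missed; instead the
    neighbourhood \<open>M\<close> of \<open>x\<close> is chosen so small that none of them is above a point of \<open>M\<close>.\<close>
  define D where "D = principal_ideal L x \<inter> (K - V)"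
  have "compactin X D"
    unfolding D_def using closedin_principal_ideal[OF x] shell by (rule closed_Int_compactin)
  then have "openin X (V - down_set D)"
    using V(1) closedin_down_set_compact by (blast intro: openin_diff)
  moreover have "x \<notin> down_set D"
    using V(2) x le_antisym by (auto simp: down_set_def D_def principal_ideal_def)
  ultimately obtain W M where W: "openin X W" "x \<in> W" "W \<subseteq> M"
    and M: "compactin X M" "M \<subseteq> V - down_set D"
    using nb V(2) unfolding neighbourhood_base_of by (meson DiffI)
  define C where "C = up_set M \<inter> (K - V)"
  have C: "compactin X C"
    unfolding C_def using closedin_up_set_compact[OF M(1)] shell by (rule closed_Int_compactin)
  define \<N> where "\<N> = {A. closedin X A \<and> A \<inter> W \<noteq> {}} \<inter>
    {A. closedin X A \<and> A \<subseteq> topspace X - C}"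
  have "openin (fell_topology X) \<N>"
    unfolding \<N>_def fell_topology_def
    by (intro openin_Int topology_generated_by_Basis) (use W(1) C in blast)+
  moreover have "principal_ideal L x \<in> \<N>"
  proof -
    have "x \<in> principal_ideal L x"
      using x by (simp add: principal_ideal_def)
    moreover have "principal_ideal L x \<inter> C = {}"
    proof -
      have False if w: "w \<in> principal_ideal L x" "w \<in> up_set M" "w \<in> K - V" for w
      proof -
        obtain m where m: "m \<in> M" "m \<sqsubseteq> w"
          using w(2) by (auto simp: up_set_def)
        have "m \<in> carrier L"
          using m(1) compactin_subset_topspace[OF M(1)] topspace_eq_carrier by blast
        moreover have "w \<in> D"
          using w by (simp add: D_def)
        ultimately have "m \<in> down_set D"
          using m(2) by (auto simp: down_set_def)
        then show False using m(1) M(2) by blast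
      qed
      then show ?thesis by (auto simp: C_def)
    qed
    ultimately show ?thesis
      using W(2) closedin_principal_ideal[OF x] closedin_subset unfolding \<N>_def by blast
  qed
  moreover have "y \<in> U" if y: "y \<in> carrier L" and yN: "principal_ideal L y \<in> \<N>" for y
  proof (rule ccontr)
    assume "y \<notin> U"
    obtain z where z: "z \<in> W" "z \<in> carrier L" "z \<sqsubseteq> y"
      using yN by (auto simp: \<N>_def principal_ideal_def)
    have "z \<in> V" "z \<in> M" using z(1) W(3) M(2) by auto
    obtain w where w: "w \<in> K - V" "w \<in> carrier L" "z \<sqsubseteq> w" "w \<sqsubseteq> y"
      using interval_meets_shell[OF conn V(1) clK V(3) z(2) \<open>z \<in> V\<close> y _ z(3)] \<open>y \<notin> U\<close> K(2)
      by blast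
    have "w \<in> C"
      using w \<open>z \<in> M\<close> by (auto simp: C_def up_set_def)
    moreover have "w \<in> principal_ideal L y"
      using w by (simp add: principal_ideal_def)
    ultimately show False using yN by (auto simp: \<N>_def)
  qed
  ultimately show thesis by (rule that)
qed

lemma open_map_principal_ideal:
  assumes lc: "locally_compact_space X" and conn: "order_connected L X"
  shows "open_map X (subtopology (fell_topology X) (principal_ideal L ` topspace X))
    (principal_ideal L)"
  unfolding open_map_def
proof (intro allI impI)
  fix U assume U: "openin X U"
  let ?I = "principal_ideal L ` topspace X"
  show "openin (subtopology (fell_topology X) ?I) (principal_ideal L ` U)"
  proof (subst openin_subopen, intro ballI)
    fix A assume "A \<in> principal_ideal L ` U"
    then obtain x where x: "x \<in> U" "A = principal_ideal L x" by blast
    obtain \<N> where \<N>: "openin (fell_topology X) \<N>" "principal_ideal L x \<in> \<N>"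
      "\<And>y. y \<in> carrier L \<Longrightarrow> principal_ideal L y \<in> \<N> \<Longrightarrow> y \<in> U"
      using fell_neighbourhood_forces_closeness[OF lc conn U x(1)] by blast
    have "openin (subtopology (fell_topology X) ?I) (\<N> \<inter> ?I)"
      using \<N>(1) by (auto simp: openin_subtopology)
    moreover have "A \<in> \<N> \<inter> ?I"
      using x \<N>(2) openin_subset[OF U] by blast
    moreover have "\<N> \<inter> ?I \<subseteq> principal_ideal L ` U"
      using \<N>(3) by (auto simp: topspace_eq_carrier)
    ultimately show "\<exists>T. openin (subtopology (fell_topology X) ?I) T \<and> A \<in> T \<and>
        T \<subseteq> principal_ideal L ` U"
      by blast
  qed
qed

end

section \<open>The embedding theorem\<close>

lemma weak_partial_order_closed_sets_order: "weak_partial_order (closed_sets_order X)"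
  by unfold_locales (auto simp: closed_sets_order_def)

theorem theorem13:
  fixes L :: "('a, 'm) gorder_scheme" and X :: "'a topology"
  assumes "hausdorff_topological_lower_semilattice L X"
    and "locally_compact_space X"
    and "order_connected L X"
  shows "topological_order_embedding L X (closed_sets_order X) (fell_topology X) (principal_ideal L)"
proof -
  interpret hausdorff_topological_lower_semilattice L X by fact
  have "principal_ideal L \<in> carrier L \<rightarrow> carrier (closed_sets_order X)"
    using closedin_principal_ideal by (simp add: closed_sets_order_def)
  moreover have "order_emb L (closed_sets_order X) (principal_ideal L)"
    unfolding order_emb_def
    using weak_partial_order_axioms weak_partial_order_closed_sets_order
      principal_ideal_subset_iff
    by (auto simp: closed_sets_order_def)
  moreover have "embedding_map X (fell_topology X) (principal_ideal L)"
    unfolding embedding_map_def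
  proof (rule bijective_open_imp_homeomorphic_map)
    show "continuous_map X (subtopology (fell_topology X) (principal_ideal L ` topspace X))
        (principal_ideal L)"
      using continuous_map_principal_ideal by (simp add: continuous_map_in_subtopology)
    show "open_map X (subtopology (fell_topology X) (principal_ideal L ` topspace X))
        (principal_ideal L)"
      using assms(2,3) by (rule open_map_principal_ideal)
    show "principal_ideal L ` topspace X =
        topspace (subtopology (fell_topology X) (principal_ideal L ` topspace X))"
      using continuous_map_image_subset_topspace[OF continuous_map_principal_ideal] by auto
    show "inj_on (principal_ideal L) (topspace X)"
    proof (rule inj_onI)
      fix x y
      assume xy: "x \<in> topspace X" "y \<in> topspace X" and "principal_ideal L x = principal_ideal L y"
      then have "x \<sqsubseteq>\<^bsub>L\<^esub> y" "y \<sqsubseteq>\<^bsub>L\<^esub> x"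
        using principal_ideal_subset_iff[of x y] principal_ideal_subset_iff[of y x]
        by (auto simp: topspace_eq_carrier)
      then show "x = y"
        using xy le_antisym by (simp add: topspace_eq_carrier)
    qed
  qed
  ultimately show ?thesis
    by (simp add: topological_order_embedding_def)
qed

end
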